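(* Let $\mathrm{U}_{k,n}^-$ be an almost-uniform matroid of rank $k$ on a ground set $E$ of size $n$ with $k <n$. Then $$\widehat{\rho}(I(\mathrm{U}_{k,n}^-))=\max\left\{\frac{(k-1)(n-k+1)}{n-1},\frac{k(n-k)}{n-1}\right\} =\begin{cases} \dfrac{k(n-k)}{n-1} & \text{ if } 2k\le n+1,\\[6pt] \dfrac{(k-1)(n-k+1)}{n-1} & \text{ if } 2k\ge n+1. \end{cases}$$
   Context: Let $\mathbb{K}$ be a field, $S=\mathbb{K}[x_e : e\in E]$ the standard graded polynomial ring, and $x^U=\prod_{i\in U}x_i$ for $U\subseteq E$. For a squarefree monomial ideal $I\subseteq S$ and $s\ge 1$, the $s$-th symbolic power is $I^{(s)}=\bigcap_{P\in \mathrm{Min}(I)}P^s$, where $\mathrm{Min}(I)$ is the set of minimal primes of $I$. The asymptotic resurgence is $\widehat{\rho}(I)=\sup\{ s/r : s,r \text{ positive integers and } I^{(st)}\not\subseteq I^{rt}\text{ for all } t\gg 0\}$. For a matroid $M$ on $E$ with set of bases $\mathcal{B}(M)$, the facet ideal is $I(M)=\langle x^B : B\in\mathcal{B}(M)\rangle$. An almost-uniform matroid $\mathrm{U}^-_{k,n}$ of rank $k$ on a set $E$ of size $n$ is a matroid whose set of bases consists of all $k$-element subsets of $E$ except exactly one. *)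

theory Defs
  imports
    "HOL-Library.Poly_Mapping"
    "HOL-Library.Extended_Real"
    "HOL-Algebra.Ideal_Product"
    "HOL-Algebra.Algebraic_Closure_Type"
begin

text \<open>
  The ground set of the matroid is the universe of a finite type \<open>'e\<close>. A polynomial in
  the variables \<open>x\<^sub>e\<close>, \<open>e :: 'e\<close>, over the field \<open>'k\<close> is a finitely supported map from
  exponent vectors \<open>'e \<Rightarrow>\<^sub>0 nat\<close> to coefficients, with convolution as multiplication.
\<close>

type_synonym ('e, 'k) mpoly = "('e \<Rightarrow>\<^sub>0 nat) \<Rightarrow>\<^sub>0 'k"

abbreviation mpoly_ring :: "('e::finite, 'k::field) mpoly ring" where
  "mpoly_ring \<equiv> ring_of_type_algebra"

definition mvar :: "'e \<Rightarrow> ('e, 'k::field) mpoly" where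
  "mvar e = Poly_Mapping.single (Poly_Mapping.single e 1) 1"

definition sqfree_monomial :: "'e::finite set \<Rightarrow> ('e, 'k::field) mpoly" where
  "sqfree_monomial U = (\<Prod>i\<in>U. mvar i)"


definition minimal_primes :: "('a, 'b) ring_scheme \<Rightarrow> 'a set \<Rightarrow> 'a set set" where
  "minimal_primes R I =
     {P. primeideal P R \<and> I \<subseteq> P \<and>
         (\<forall>Q. primeideal Q R \<and> I \<subseteq> Q \<and> Q \<subseteq> P \<longrightarrow> Q = P)}"

abbreviation ideal_power :: "('a, 'b) ring_scheme \<Rightarrow> 'a set \<Rightarrow> nat \<Rightarrow> 'a set" where
  "ideal_power R I s \<equiv> I [^]\<^bsub>ideals_set R\<^esub> s"

text \<open>This notion of symbolic power is the usual one for ideals without embedded primes,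
  in particular for squarefree monomial ideals.\<close>

definition symbolic_power :: "('a, 'b) ring_scheme \<Rightarrow> 'a set \<Rightarrow> nat \<Rightarrow> 'a set" where
  "symbolic_power R I s = (\<Inter>P\<in>minimal_primes R I. ideal_power R P s)"

text \<open>The supremum is taken in the extended reals, so that a finite value includes the
  claim that the set is nonempty and bounded.\<close>

definition asymptotic_resurgence :: "('a, 'b) ring_scheme \<Rightarrow> 'a set \<Rightarrow> ereal" where
  "asymptotic_resurgence R I =
     Sup {ereal (real s / real r) | s r. s \<ge> 1 \<and> r \<ge> 1 \<and>
            (\<forall>\<^sub>F t in sequentially.
               \<not> symbolic_power R I (s * t) \<subseteq> ideal_power R I (r * t))}"


text \<open>Matroids are given by their ground set and their set of bases.\<close>

definition matroid :: "'e set \<Rightarrow> 'e set set \<Rightarrow> bool" where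
  "matroid E \<B> \<longleftrightarrow>
     finite E \<and> \<B> \<subseteq> Pow E \<and> \<B> \<noteq> {} \<and>
     (\<forall>A\<in>\<B>. \<forall>B\<in>\<B>. \<forall>a\<in>A - B. \<exists>b\<in>B - A. insert b (A - {a}) \<in> \<B>)"

definition almost_uniform_matroid :: "'e set \<Rightarrow> nat \<Rightarrow> 'e set set \<Rightarrow> bool" where
  "almost_uniform_matroid E k \<B> \<longleftrightarrow>
     matroid E \<B> \<and>
     (\<exists>B\<^sub>0. B\<^sub>0 \<subseteq> E \<and> card B\<^sub>0 = k \<and> \<B> = {B. B \<subseteq> E \<and> card B = k} - {B\<^sub>0})"

definition facet_ideal :: "'e::finite set set \<Rightarrow> ('e, 'k::field) mpoly set" where
  "facet_ideal \<B> = Idl\<^bsub>mpoly_ring\<^esub> (sqfree_monomial ` \<B>)"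

end

theory Submission
  imports Defs
begin

text \<open>
  The minimal primes of the facet ideal are generated by the variables in the cocircuits, so the
  \<open>s\<close>-th symbolic power consists of the polynomials whose exponents \<open>a\<close> satisfy \<open>a(C) \<ge> s\<close> on
  the complement of the missing set \<open>B\<^sub>0\<close> and on every \<open>C\<close> with \<open>n - k + 1\<close> elements. An
  exponent \<open>a\<close> with \<open>a(E - B\<^sub>0) \<ge> m\<close> and \<open>\<Sum>e. min (a e) m \<ge> m k\<close> dominates a sum of \<open>m\<close>
  bases by wrapping around, and averaging over cocircuits yields these two inequalities as soon
  as \<open>s / m\<close> is at least both quotients. Conversely, the constant exponents on the deletion of an
  element of \<open>B\<^sub>0\<close> and on the contraction of an element outside \<open>B\<^sub>0\<close>, where the matroid becomes
  uniform of rank \<open>k\<close> and \<open>k - 1\<close> on \<open>n - 1\<close> elements, show that no smaller bound works.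
\<close>

section \<open>Monomial ideals\<close>

abbreviation lookup :: "('a \<Rightarrow>\<^sub>0 'b::zero) \<Rightarrow> 'a \<Rightarrow> 'b" where
  "lookup \<equiv> Poly_Mapping.lookup"

lemma type_algebra_simps [simp]:
  "carrier ring_of_type_algebra = UNIV"
  "x \<otimes>\<^bsub>ring_of_type_algebra\<^esub> y = x * y"
  "x \<oplus>\<^bsub>ring_of_type_algebra\<^esub> y = x + y"
  "\<zero>\<^bsub>ring_of_type_algebra\<^esub> = 0"
  "\<one>\<^bsub>ring_of_type_algebra\<^esub> = 1"
  by (simp_all add: ring_of_type_algebra_def)

lemma ideal_type_algebraI:
  fixes I :: "'a::comm_ring_1 set"
  assumes "0 \<in> I" "\<And>x y. x \<in> I \<Longrightarrow> y \<in> I \<Longrightarrow> x + y \<in> I" "\<And>x y. x \<in> I \<Longrightarrow> y * x \<in> I"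
  shows "ideal I ring_of_type_algebra"
proof (rule idealI[OF ring_from_type_algebra])
  have inv: "inv\<^bsub>add_monoid ring_of_type_algebra\<^esub> x = - x" for x :: 'a
    by (metis a_inv_def abelian_group.minus_equality add.left_inverse iso_tuple_UNIV_I
        ring.is_abelian_group ring_from_type_algebra type_algebra_simps(1,3,4))
  show "subgroup I (add_monoid ring_of_type_algebra)"
  proof (rule group.subgroupI[OF abelian_group.a_group[OF ring.is_abelian_group[OF ring_from_type_algebra]]])
    show "inv\<^bsub>add_monoid ring_of_type_algebra\<^esub> x \<in> I" if "x \<in> I" for x
      unfolding inv using assms(3)[OF that, of "-1"] by simp
  qed (use assms(1,2) in auto)
qed (use assms(3) in \<open>auto simp: mult.commute\<close>)

lemma ideal_type_algebraD:
  assumes "ideal I (ring_of_type_algebra :: 'a::comm_ring_1 ring)"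
  shows "0 \<in> I" "\<And>x y. x \<in> I \<Longrightarrow> y \<in> I \<Longrightarrow> x + y \<in> I" "\<And>x y. x \<in> I \<Longrightarrow> y * x \<in> I"
  using additive_subgroup.zero_closed[OF ideal.axioms(1)[OF assms]]
    additive_subgroup.a_closed[OF ideal.axioms(1)[OF assms]] ideal.I_l_closed[OF assms]
  by auto

lemma ideal_type_algebra_sum:
  assumes "ideal I (ring_of_type_algebra :: 'a::comm_ring_1 ring)" "\<And>x. x \<in> A \<Longrightarrow> f x \<in> I"
  shows "sum f A \<in> I"
  using assms(2) by (induction A rule: infinite_finite_induct)
    (auto simp: ideal_type_algebraD[OF assms(1)])

definition up_closed :: "'a::plus set \<Rightarrow> bool" where
  "up_closed U \<longleftrightarrow> (\<forall>a\<in>U. \<forall>b. b + a \<in> U)"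

text \<open>An ideal as soon as \<open>U\<close> is \<open>up_closed\<close>; containments between
  such ideals become statements about exponents.\<close>

definition monomial_ideal :: "('e \<Rightarrow>\<^sub>0 nat) set \<Rightarrow> ('e, 'k::field) mpoly set" where
  "monomial_ideal U = {f. Poly_Mapping.keys f \<subseteq> U}"

lemma single_mem_monomial_ideal [simp]:
  "Poly_Mapping.single a c \<in> monomial_ideal U \<longleftrightarrow> c = 0 \<or> a \<in> U"
  by (auto simp: monomial_ideal_def)

lemma poly_mapping_eq_sum_single:
  fixes f :: "'a \<Rightarrow>\<^sub>0 'b::comm_monoid_add"
  shows "f = (\<Sum>a\<in>Poly_Mapping.keys f. Poly_Mapping.single a (lookup f a))"
  by (rule poly_mapping_eqI) (auto simp: lookup_sum lookup_single when_def in_keys_iff)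

lemma monomial_ideal_is_ideal:
  assumes "up_closed U"
  shows "ideal (monomial_ideal U :: ('e::finite, 'k::field) mpoly set) mpoly_ring"
proof (rule ideal_type_algebraI)
  fix x y :: "('e, 'k) mpoly"
  assume x: "x \<in> monomial_ideal U"
  show "y * x \<in> monomial_ideal U"
    using x assms keys_mult[of y x] unfolding monomial_ideal_def up_closed_def by blast
  assume "y \<in> monomial_ideal U"
  with x show "x + y \<in> monomial_ideal U"
    using keys_add[of x y] unfolding monomial_ideal_def by blast
qed (simp add: monomial_ideal_def)

lemma monomial_ideal_subsetI:
  assumes "ideal I (mpoly_ring :: ('e::finite, 'k::field) mpoly ring)"
    and "\<And>a c. a \<in> U \<Longrightarrow> Poly_Mapping.single a c \<in> I"
  shows "monomial_ideal U \<subseteq> I"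
proof
  fix f :: "('e, 'k) mpoly" assume "f \<in> monomial_ideal U"
  then show "f \<in> I"
    using assms by (subst poly_mapping_eq_sum_single)
      (auto simp: monomial_ideal_def intro!: ideal_type_algebra_sum)
qed

lemma ideal_prod_monomial_ideal:
  assumes "up_closed U" "up_closed V"
  shows "ideal_prod mpoly_ring (monomial_ideal U) (monomial_ideal V)
    = (monomial_ideal {u + v | u v. u \<in> U \<and> v \<in> V} :: ('e::finite, 'k::field) mpoly set)"
    (is "?L = monomial_ideal ?W")
proof
  show "?L \<subseteq> monomial_ideal ?W"
  proof
    fix f assume "f \<in> ?L"
    then show "f \<in> monomial_ideal ?W"
    proof induction
      case (prod i j)
      then show ?case
        using keys_mult[of i j] unfolding monomial_ideal_def by fastforce
    next
      case (sum f g)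
      then show ?case
        using keys_add[of f g] unfolding monomial_ideal_def by fastforce
    qed
  qed
  have "ideal ?L mpoly_ring"
    by (intro ring.ideal_prod_is_ideal ring_from_type_algebra monomial_ideal_is_ideal assms)
  then show "monomial_ideal ?W \<subseteq> ?L"
  proof (rule monomial_ideal_subsetI)
    fix a and c :: 'k assume "a \<in> ?W"
    then obtain u v where uv: "a = u + v" "u \<in> U" "v \<in> V" by blast
    have "Poly_Mapping.single u c \<otimes>\<^bsub>mpoly_ring\<^esub> Poly_Mapping.single v 1 \<in> ?L"
      by (rule ideal_prod.prod) (use uv in auto)
    then show "Poly_Mapping.single a c \<in> ?L"
      by (simp add: uv(1) mult_single)
  qed
qed

text \<open>The value at \<open>0\<close> is \<open>UNIV\<close>, not \<open>{0}\<close>, because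
  the zeroth power of an ideal is the whole ring.\<close>

primrec sumset_power :: "'a::ab_semigroup_add set \<Rightarrow> nat \<Rightarrow> 'a set" where
  "sumset_power U 0 = UNIV"
| "sumset_power U (Suc m) = {u + v | u v. u \<in> sumset_power U m \<and> v \<in> U}"

lemma up_closed_sumset_power: "up_closed (sumset_power U m)"
proof (induction m)
  case (Suc m)
  then show ?case
    unfolding up_closed_def by (auto simp: add.assoc[symmetric]) blast
qed (simp add: up_closed_def)

lemma ideal_power_monomial_ideal:
  assumes "up_closed U"
  shows "ideal_power mpoly_ring (monomial_ideal U :: ('e::finite, 'k::field) mpoly set) m
    = monomial_ideal (sumset_power U m)"
proof (induction m)
  case 0
  then show ?case by (simp add: nat_pow_def ideals_set_def monomial_ideal_def)
next
  case (Suc m)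
  have "ideal_power mpoly_ring (monomial_ideal U :: ('e::finite, 'k::field) mpoly set) (Suc m)
    = ideal_prod mpoly_ring (ideal_power mpoly_ring (monomial_ideal U) m) (monomial_ideal U)"
    by (simp add: nat_pow_def ideals_set_def)
  then show ?case
    by (simp add: Suc ideal_prod_monomial_ideal up_closed_sumset_power assms)
qed

section \<open>Primes generated by variables, and their powers\<close>

definition weight :: "'e set \<Rightarrow> ('e \<Rightarrow>\<^sub>0 nat) \<Rightarrow> nat" where
  "weight C a = (\<Sum>e\<in>C. lookup a e)"

lemma weight_add: "weight C (a + b) = weight C a + weight C b"
  by (simp add: weight_def lookup_add sum.distrib)

lemma weight_mono: "finite D \<Longrightarrow> C \<subseteq> D \<Longrightarrow> weight C a \<le> weight D a"
  by (simp add: weight_def sum_mono2)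

lemma weight_single: "finite C \<Longrightarrow> weight C (Poly_Mapping.single e m) = (if e \<in> C then m else 0)"
  by (auto simp: weight_def lookup_single when_def)

text \<open>The ideal generated by the variables in \<open>C\<close>: a monomial belongs to it iff
  its degree \<open>weight C\<close> in these variables is positive.\<close>

definition coord_prime :: "'e set \<Rightarrow> ('e, 'k::field) mpoly set" where
  "coord_prime C = monomial_ideal {a. weight C a \<ge> 1}"

lemma diff_add_single:
  assumes "lookup a e \<ge> 1"
  shows "a = (a - Poly_Mapping.single e (1::nat)) + Poly_Mapping.single e 1"
  by (rule poly_mapping_eqI) (use assms in \<open>auto simp: lookup_add lookup_minus lookup_single when_def\<close>)

text \<open>Splitting off a unit vector supported in \<open>C\<close> lowers the weight by exactly
  one. Hence the powers of \<open>coord_prime C\<close> are cut out by a single inequality.\<close>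

lemma sumset_power_weight:
  assumes "finite C"
  shows "sumset_power {a. weight C a \<ge> 1} m = {a. weight C a \<ge> m}"
proof (induction m)
  case (Suc m)
  show ?case unfolding sumset_power.simps Suc
  proof safe
    fix u v assume "m \<le> weight C u" "1 \<le> weight C v"
    then show "Suc m \<le> weight C (u + v)" by (simp add: weight_add)
  next
    fix a assume a: "Suc m \<le> weight C a"
    then have "weight C a \<noteq> 0" by simp
    then obtain e where e: "e \<in> C" "lookup a e \<ge> 1"
      using assms by (auto simp: weight_def Suc_le_eq)
    let ?x = "Poly_Mapping.single e (1::nat)"
    have eq: "a = (a - ?x) + ?x" using e(2) by (rule diff_add_single)
    moreover have "weight C a = weight C (a - ?x) + weight C ?x"
      using arg_cong[OF eq, of "weight C"] by (simp only: weight_add)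
    ultimately show "\<exists>u v. a = u + v \<and> u \<in> {a. m \<le> weight C a} \<and> v \<in> {a. 1 \<le> weight C a}"
      using a e(1) assms by (intro exI[of _ "a - ?x"] exI[of _ ?x]) (auto simp: weight_single)
  qed
qed simp

lemma up_closed_weight: "up_closed {a. weight C a \<ge> m}"
  by (simp add: up_closed_def weight_add)

lemma ideal_power_coord_prime:
  "ideal_power mpoly_ring (coord_prime C :: ('e::finite, 'k::field) mpoly set) m
    = monomial_ideal {a. weight C a \<ge> m}"
  by (simp add: coord_prime_def ideal_power_monomial_ideal up_closed_weight sumset_power_weight
      del: One_nat_def)

lemma mvar_mem_coord_prime: "(mvar e :: ('e::finite, 'k::field) mpoly) \<in> coord_prime C \<longleftrightarrow> e \<in> C"
  by (simp add: coord_prime_def mvar_def weight_single)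

lemma coord_prime_subset:
  assumes Q: "ideal Q (mpoly_ring :: ('e::finite, 'k::field) mpoly ring)"
    and C: "\<And>e. e \<in> C \<Longrightarrow> mvar e \<in> Q"
  shows "coord_prime C \<subseteq> Q"
  unfolding coord_prime_def
proof (rule monomial_ideal_subsetI[OF Q])
  fix a and c :: 'k assume "a \<in> {a. weight C a \<ge> 1}"
  then have "weight C a \<noteq> 0" by simp
  then obtain e where e: "e \<in> C" "lookup a e \<ge> 1"
    by (auto simp: weight_def Suc_le_eq)
  have "Poly_Mapping.single (a - Poly_Mapping.single e 1) c * mvar e \<in> Q"
    by (rule ideal_type_algebraD(3)[OF Q C[OF e(1)]])
  then have "Poly_Mapping.single ((a - Poly_Mapping.single e 1) + Poly_Mapping.single e 1) c \<in> Q"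
    by (simp add: mvar_def mult_single)
  then show "Poly_Mapping.single a c \<in> Q"
    by (simp only: diff_add_single[OF e(2), symmetric])
qed

text \<open>\<open>\<nat>\<^sup>Y\<close> is a unique product semigroup: maximise one coordinate after the other.\<close>

lemma unique_sum_on:
  fixes F G :: "('e \<Rightarrow>\<^sub>0 nat) set"
  assumes "finite Y" "finite F" "F \<noteq> {}" "finite G" "G \<noteq> {}"
  shows "\<exists>a\<in>F. \<exists>b\<in>G. \<forall>a'\<in>F. \<forall>b'\<in>G. (\<forall>x\<in>Y. lookup a' x + lookup b' x = lookup a x + lookup b x) \<longrightarrow>
    (\<forall>x\<in>Y. lookup a' x = lookup a x \<and> lookup b' x = lookup b x)"
  using assms
proof (induction Y arbitrary: F G)
  case empty
  then show ?case by auto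
next
  case (insert x Y)
  define top where "top = (\<lambda>H::('e \<Rightarrow>\<^sub>0 nat) set. {a\<in>H. lookup a x = Max ((\<lambda>a. lookup a x) ` H)})"
  have top: "finite (top H)" "top H \<noteq> {}" "top H \<subseteq> H"
    "\<And>a a'. a' \<in> H \<Longrightarrow> a \<in> top H \<Longrightarrow> lookup a' x \<le> lookup a x"
    "\<And>a a'. a' \<in> H \<Longrightarrow> a \<in> top H \<Longrightarrow> lookup a' x = lookup a x \<Longrightarrow> a' \<in> top H"
    if "finite H" "H \<noteq> {}" for H
  proof -
    have "Max ((\<lambda>a. lookup a x) ` H) \<in> (\<lambda>a. lookup a x) ` H"
      using that by (intro Max_in) auto
    then show "top H \<noteq> {}" by (auto simp: top_def)
  qed (use that in \<open>auto simp: top_def\<close>)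
  obtain a b where a: "a \<in> top F" and b: "b \<in> top G"
    and uniq: "\<forall>a'\<in>top F. \<forall>b'\<in>top G.
      (\<forall>x\<in>Y. lookup a' x + lookup b' x = lookup a x + lookup b x) \<longrightarrow>
      (\<forall>x\<in>Y. lookup a' x = lookup a x \<and> lookup b' x = lookup b x)"
    using insert.IH[OF top(1,2)[OF insert.prems(1,2)] top(1,2)[OF insert.prems(3,4)]] by blast
  show ?case
  proof (rule bexI[of _ a], rule bexI[of _ b], intro ballI impI)
    fix a' b' y
    assume a': "a' \<in> F" and b': "b' \<in> G" and y: "y \<in> insert x Y"
      and eq: "\<forall>x\<in>insert x Y. lookup a' x + lookup b' x = lookup a x + lookup b x"
    have "lookup a' x + lookup b' x = lookup a x + lookup b x" using eq by simp
    then have x: "lookup a' x = lookup a x" "lookup b' x = lookup b x"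
      using top(4)[OF insert.prems(1,2) a' a] top(4)[OF insert.prems(3,4) b' b] by linarith+
    then have "a' \<in> top F" "b' \<in> top G"
      using top(5)[OF insert.prems(1,2) a' a] top(5)[OF insert.prems(3,4) b' b] by blast+
    then show "lookup a' y = lookup a y \<and> lookup b' y = lookup b y"
      using uniq eq y x by blast
  qed (use a b top(3)[OF insert.prems(1,2)] top(3)[OF insert.prems(3,4)] in blast)+
qed

lemma unique_sum:
  fixes F G :: "('e::finite \<Rightarrow>\<^sub>0 nat) set"
  assumes "finite F" "F \<noteq> {}" "finite G" "G \<noteq> {}"
  obtains a b where "a \<in> F" "b \<in> G"
    "\<And>a' b'. a' \<in> F \<Longrightarrow> b' \<in> G \<Longrightarrow> a' + b' = a + b \<Longrightarrow> a' = a \<and> b' = b"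
proof -
  obtain a b where a: "a \<in> F" and b: "b \<in> G" and uniq:
    "\<forall>a'\<in>F. \<forall>b'\<in>G. (\<forall>x\<in>UNIV. lookup a' x + lookup b' x = lookup a x + lookup b x) \<longrightarrow>
    (\<forall>x\<in>UNIV. lookup a' x = lookup a x \<and> lookup b' x = lookup b x)"
    using unique_sum_on[OF finite_UNIV assms] by blast
  show ?thesis
  proof (rule that[OF a b])
    fix a' b' assume a': "a' \<in> F" and b': "b' \<in> G" and eq: "a' + b' = a + b"
    have "lookup a' x + lookup b' x = lookup a x + lookup b x" for x
      using arg_cong[OF eq, of "\<lambda>p. lookup p x"] by (simp add: lookup_add)
    then have "\<forall>x\<in>UNIV. lookup a' x = lookup a x \<and> lookup b' x = lookup b x"
      using uniq a' b' by blast
    then show "a' = a \<and> b' = b" by (auto intro: poly_mapping_eqI)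
  qed
qed

text \<open>No second pair of terms contributes to the coefficient at \<open>a + b\<close>, so
  nothing cancels. If \<open>a\<close> or \<open>b\<close> lies outside the support, both sides are
  zero.\<close>

lemma lookup_mult_unique:
  fixes f g :: "('a::monoid_add \<Rightarrow>\<^sub>0 'b::semiring_0)"
  assumes "\<And>a' b'. a' \<in> Poly_Mapping.keys f \<Longrightarrow> b' \<in> Poly_Mapping.keys g \<Longrightarrow>
    a' + b' = a + b \<Longrightarrow> a' = a \<and> b' = b"
  shows "lookup (f * g) (a + b) = lookup f a * lookup g b"
proof -
  have inner: "(\<Sum>q. lookup g q when a + b = l + q) = (lookup g b when l = a)"
    if "l \<in> Poly_Mapping.keys f" for l
  proof -
    have "(\<lambda>q. lookup g q when a + b = l + q) = (\<lambda>q. (lookup g b when l = a) when q = b)"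
    proof
      fix q
      show "(lookup g q when a + b = l + q) = ((lookup g b when l = a) when q = b)"
      proof (cases "q \<in> Poly_Mapping.keys g \<and> a + b = l + q")
        case True
        then have "l = a" "q = b" using assms[OF that, of q] by metis+
        then show ?thesis by simp
      next
        case False
        have "(lookup g q when a + b = l + q) = 0"
          using False by (cases "a + b = l + q") (simp_all add: in_keys_iff)
        moreover have "((lookup g b when l = a) when q = b) = 0"
          using False by (cases "l = a \<and> q = b") (auto simp: in_keys_iff)
        ultimately show ?thesis by simp
      qed
    qed
    then show ?thesis by (simp only: Sum_any_when_equal)
  qed
  have "(\<lambda>l. lookup f l * (\<Sum>q. lookup g q when a + b = l + q))
    = (\<lambda>l. (lookup f a * lookup g b) when l = a)"
  proof
    fix l
    show "lookup f l * (\<Sum>q. lookup g q when a + b = l + q) = ((lookup f a * lookup g b) when l = a)"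
      using inner[of l] by (cases "l \<in> Poly_Mapping.keys f") (auto simp: when_def in_keys_iff)
  qed
  then show ?thesis by (simp only: lookup_mult Sum_any_when_equal)
qed

text \<open>If both factors have terms without variables of \<open>C\<close>, choose among these
  terms a pair whose exponent sum is attained only once. Its product survives in
  \<open>f * g\<close> and has weight zero, so \<open>f * g\<close> is not in the ideal.\<close>

lemma coord_prime_is_prime:
  "primeideal (coord_prime C :: ('e::finite, 'k::field) mpoly set) mpoly_ring"
proof (rule primeidealI)
  show "ideal (coord_prime C :: ('e::finite, 'k::field) mpoly set) mpoly_ring"
    unfolding coord_prime_def by (intro monomial_ideal_is_ideal up_closed_weight)
  show "cring (mpoly_ring :: ('e::finite, 'k::field) mpoly ring)"
    by (rule cring_from_type_algebra)
  have "(1 :: ('e, 'k) mpoly) \<notin> coord_prime C"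
    by (simp add: coord_prime_def monomial_ideal_def weight_def)
  then show "carrier mpoly_ring \<noteq> (coord_prime C :: ('e, 'k) mpoly set)"
    by auto
next
  fix f g :: "('e, 'k) mpoly"
  assume "f \<otimes>\<^bsub>mpoly_ring\<^esub> g \<in> coord_prime C"
  then have fg: "f * g \<in> coord_prime C" by simp
  show "f \<in> coord_prime C \<or> g \<in> coord_prime C"
  proof (rule ccontr)
    define F where "F = {a \<in> Poly_Mapping.keys f. weight C a = 0}"
    define G where "G = {a \<in> Poly_Mapping.keys g. weight C a = 0}"
    assume "\<not> ?thesis"
    then have "F \<noteq> {}" "G \<noteq> {}"
      by (auto simp: coord_prime_def monomial_ideal_def F_def G_def)
    moreover have "finite F" "finite G" by (auto simp: F_def G_def)
    ultimately obtain a b where ab: "a \<in> F" "b \<in> G"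
      "\<And>a' b'. a' \<in> F \<Longrightarrow> b' \<in> G \<Longrightarrow> a' + b' = a + b \<Longrightarrow> a' = a \<and> b' = b"
      using unique_sum by metis
    \<comment> \<open>Weights are additive and nonnegative: two keys whose sum has weight zero lie
      in \<open>F\<close> and \<open>G\<close>, so uniqueness extends to all keys.\<close>
    have "a' = a \<and> b' = b"
      if "a' \<in> Poly_Mapping.keys f" "b' \<in> Poly_Mapping.keys g" "a' + b' = a + b" for a' b'
    proof -
      have "weight C a' + weight C b' = weight C a + weight C b"
        using that(3) by (simp flip: weight_add)
      with that ab show ?thesis by (auto simp: F_def G_def)
    qed
    then have "lookup (f * g) (a + b) = lookup f a * lookup g b"
      by (rule lookup_mult_unique)
    also have "\<dots> \<noteq> 0" using ab by (auto simp: F_def G_def in_keys_iff)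
    finally have "a + b \<in> Poly_Mapping.keys (f * g)" by (simp add: in_keys_iff)
    moreover have "weight C (a + b) = 0" using ab by (simp add: F_def G_def weight_add)
    ultimately show False using fg by (auto simp: coord_prime_def monomial_ideal_def)
  qed
qed

section \<open>Facet ideals and their minimal primes\<close>

definition set_exponent :: "'e set \<Rightarrow> 'e \<Rightarrow>\<^sub>0 nat" where
  "set_exponent U = (\<Sum>e\<in>U. Poly_Mapping.single e 1)"

lemma lookup_set_exponent:
  "finite U \<Longrightarrow> lookup (set_exponent U) e = (if e \<in> U then 1 else 0)"
  by (simp add: set_exponent_def lookup_sum lookup_single when_def)

lemma sqfree_monomial_eq_single:
  "(sqfree_monomial U :: ('e::finite, 'k::field) mpoly) = Poly_Mapping.single (set_exponent U) 1"
proof -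
  have "finite U" by simp
  then show ?thesis
    by (induction U) (simp_all add: sqfree_monomial_def set_exponent_def mvar_def mult_single)
qed

definition facet_exponents :: "'e set set \<Rightarrow> ('e \<Rightarrow>\<^sub>0 nat) set" where
  "facet_exponents \<B> = {a. \<exists>B\<in>\<B>. \<forall>e\<in>B. lookup a e \<ge> 1}"

lemma up_closed_facet_exponents: "up_closed (facet_exponents \<B>)"
  unfolding up_closed_def facet_exponents_def by (fastforce simp: lookup_add)

lemma facet_ideal_eq:
  "(facet_ideal \<B> :: ('e::finite, 'k::field) mpoly set) = monomial_ideal (facet_exponents \<B>)"
proof
  let ?G = "sqfree_monomial ` \<B> :: ('e, 'k) mpoly set"
  have "?G \<subseteq> monomial_ideal (facet_exponents \<B>)"
    by (auto simp: sqfree_monomial_eq_single facet_exponents_def lookup_set_exponent)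
  then show "facet_ideal \<B> \<subseteq> (monomial_ideal (facet_exponents \<B>) :: ('e, 'k) mpoly set)"
    unfolding facet_ideal_def
    by (intro ring.genideal_minimal ring_from_type_algebra monomial_ideal_is_ideal
        up_closed_facet_exponents)
  have ideal: "ideal (facet_ideal \<B> :: ('e, 'k) mpoly set) mpoly_ring"
    unfolding facet_ideal_def by (intro ring.genideal_ideal ring_from_type_algebra) simp
  then show "monomial_ideal (facet_exponents \<B>) \<subseteq> (facet_ideal \<B> :: ('e, 'k) mpoly set)"
  proof (rule monomial_ideal_subsetI)
    fix a and c :: 'k assume "a \<in> facet_exponents \<B>"
    then obtain B where B: "B \<in> \<B>" "\<forall>e\<in>B. lookup a e \<ge> 1"
      by (auto simp: facet_exponents_def)
    have a: "(a - set_exponent B) + set_exponent B = a"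
      by (rule poly_mapping_eqI) (use B(2) in \<open>auto simp: lookup_add lookup_minus lookup_set_exponent\<close>)
    have "sqfree_monomial B \<in> (facet_ideal \<B> :: ('e, 'k) mpoly set)"
      unfolding facet_ideal_def
      using ring.genideal_self[OF ring_from_type_algebra, of ?G] B(1) by auto
    then have "Poly_Mapping.single (a - set_exponent B) c * sqfree_monomial B
        \<in> (facet_ideal \<B> :: ('e, 'k) mpoly set)"
      by (rule ideal_type_algebraD(3)[OF ideal])
    then show "Poly_Mapping.single a c \<in> (facet_ideal \<B> :: ('e, 'k) mpoly set)"
      by (simp add: sqfree_monomial_eq_single mult_single a)
  qed
qed

lemma ideal_power_facet_ideal:
  "ideal_power mpoly_ring (facet_ideal \<B> :: ('e::finite, 'k::field) mpoly set) m
    = monomial_ideal (sumset_power (facet_exponents \<B>) m)"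
  by (simp add: facet_ideal_eq ideal_power_monomial_ideal up_closed_facet_exponents)

text \<open>The second hypothesis says that \<open>x^a\<close> is divisible by the product of the
  \<open>m\<close> generators \<open>x^(S j)\<close>; the induction divides by the last one.\<close>

lemma mem_sumset_power_facet_exponentsI:
  fixes a :: "'e::finite \<Rightarrow>\<^sub>0 nat"
  assumes "\<And>j. j < m \<Longrightarrow> S j \<in> \<B>" "\<And>e. card {j. j < m \<and> e \<in> S j} \<le> lookup a e"
  shows "a \<in> sumset_power (facet_exponents \<B>) m"
  using assms
proof (induction m arbitrary: a)
  case (Suc m)
  let ?v = "set_exponent (S m)"
  have split: "card {j. j < Suc m \<and> e \<in> S j} = card {j. j < m \<and> e \<in> S j} + (if e \<in> S m then 1 else 0)"
    for e
  proof -
    have "{j. j < Suc m \<and> e \<in> S j} = {j. j < m \<and> e \<in> S j} \<union> (if e \<in> S m then {m} else {})"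
      by (auto simp: less_Suc_eq)
    then show ?thesis by (simp add: card_insert_if)
  qed
  have "card {j. j < m \<and> e \<in> S j} \<le> lookup (a - ?v) e" for e
    using Suc.prems(2)[of e] by (auto simp: split lookup_minus lookup_set_exponent split: if_splits)
  then have "a - ?v \<in> sumset_power (facet_exponents \<B>) m"
    using Suc.prems(1) by (intro Suc.IH) auto
  moreover have "?v \<in> facet_exponents \<B>"
    using Suc.prems(1)[of m] by (auto simp: facet_exponents_def lookup_set_exponent)
  moreover have "a = (a - ?v) + ?v"
  proof (rule poly_mapping_eqI)
    show "lookup a e = lookup (a - ?v + ?v) e" for e
      using Suc.prems(2)[of e] by (auto simp: split lookup_add lookup_minus lookup_set_exponent split: if_splits)
  qed
  ultimately show ?case unfolding sumset_power.simps by blast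
qed simp

text \<open>An obstruction to membership in the \<open>m\<close>-th power: each of the
  \<open>m\<close> bases dominated by \<open>a\<close> spends at least \<open>c\<close> units of
  weight on \<open>W\<close>.\<close>

lemma weight_sumset_power_facet_exponents:
  assumes "finite W" "\<And>B. B \<in> \<B> \<Longrightarrow> card (W \<inter> B) \<ge> c"
    and "a \<in> sumset_power (facet_exponents \<B>) m"
  shows "weight W a \<ge> m * c"
  using assms(3)
proof (induction m arbitrary: a)
  case (Suc m)
  then obtain u v where uv: "a = u + v" "u \<in> sumset_power (facet_exponents \<B>) m"
    "v \<in> facet_exponents \<B>" by auto
  then obtain B where B: "B \<in> \<B>" "\<forall>e\<in>B. lookup v e \<ge> 1"
    by (auto simp: facet_exponents_def)
  have "c \<le> card (W \<inter> B)" using assms(2) B(1) .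
  also have "\<dots> = (\<Sum>e\<in>W \<inter> B. 1)" by simp
  also have "\<dots> \<le> weight (W \<inter> B) v" unfolding weight_def using B(2) by (intro sum_mono) auto
  also have "\<dots> \<le> weight W v" by (rule weight_mono) (use assms(1) in auto)
  finally show ?case using Suc.IH[OF uv(2)] by (simp add: uv(1) weight_add)
qed simp

text \<open>For the bases of a matroid, the minimal such sets are the cocircuits.\<close>

definition transversal :: "'e set set \<Rightarrow> 'e set \<Rightarrow> bool" where
  "transversal \<B> C \<longleftrightarrow> (\<forall>B\<in>\<B>. B \<inter> C \<noteq> {})"

lemma facet_ideal_subset_coord_prime:
  "(facet_ideal \<B> :: ('e::finite, 'k::field) mpoly set) \<subseteq> coord_prime C" if "transversal \<B> C"
proof -
  have "facet_exponents \<B> \<subseteq> {a. weight C a \<ge> 1}"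
    using that by (fastforce simp: facet_exponents_def transversal_def weight_def Suc_le_eq)
  then show ?thesis
    unfolding facet_ideal_eq coord_prime_def monomial_ideal_def by blast
qed

lemma primeideal_prodD:
  fixes f :: "'i \<Rightarrow> 'a::comm_ring_1"
  assumes "primeideal Q ring_of_type_algebra" "finite A" "prod f A \<in> Q"
  shows "\<exists>x\<in>A. f x \<in> Q"
  using assms(2,3)
proof (induction A)
  case empty
  then show ?case
    using ideal.one_imp_carrier[OF primeideal.axioms(1)[OF assms(1)]] primeideal.I_notcarr[OF assms(1)]
    by simp
next
  case (insert x A)
  then show ?case using primeideal.I_prime[OF assms(1), of "f x" "prod f A"] by auto
qed

lemma transversal_variables_of_prime:
  assumes "primeideal Q (mpoly_ring :: ('e::finite, 'k::field) mpoly ring)" "facet_ideal \<B> \<subseteq> Q"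
  shows "transversal \<B> {e. mvar e \<in> Q}"
  unfolding transversal_def
proof
  fix B assume "B \<in> \<B>"
  then have "(sqfree_monomial B :: ('e, 'k) mpoly) \<in> facet_ideal \<B>"
    by (auto simp: facet_ideal_eq sqfree_monomial_eq_single facet_exponents_def lookup_set_exponent)
  then have "(\<Prod>e\<in>B. mvar e) \<in> Q"
    using assms(2) by (auto simp: sqfree_monomial_def)
  then show "B \<inter> {e. mvar e \<in> Q} \<noteq> {}"
    using primeideal_prodD[OF assms(1), of B mvar] by auto
qed

text \<open>The variables in \<open>P\<close> form a transversal, since a prime containing
  \<open>x^B\<close> contains one of its variables. They generate a prime below \<open>P\<close>
  that still contains the facet ideal; minimality makes it equal to \<open>P\<close>.\<close>

lemma minimal_primes_facet_idealE:
  assumes "P \<in> minimal_primes mpoly_ring (facet_ideal \<B> :: ('e::finite, 'k::field) mpoly set)"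
  obtains C where "transversal \<B> C" "P = coord_prime C"
proof
  let ?C = "{e. mvar e \<in> P}"
  have P: "primeideal P mpoly_ring" "facet_ideal \<B> \<subseteq> P"
    "\<And>Q. primeideal Q mpoly_ring \<Longrightarrow> facet_ideal \<B> \<subseteq> Q \<Longrightarrow> Q \<subseteq> P \<Longrightarrow> Q = P"
    using assms by (auto simp: minimal_primes_def)
  show tr: "transversal \<B> ?C" using transversal_variables_of_prime P(1,2) .
  show "P = coord_prime ?C"
    using P(3)[OF coord_prime_is_prime facet_ideal_subset_coord_prime[OF tr]]
      coord_prime_subset[OF primeideal.axioms(1)[OF P(1)], of ?C] by simp
qed

lemma coord_prime_mem_minimal_primes:
  assumes "transversal \<B> C" "\<And>D. D \<subset> C \<Longrightarrow> \<not> transversal \<B> D"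
  shows "coord_prime C \<in> minimal_primes mpoly_ring (facet_ideal \<B> :: ('e::finite, 'k::field) mpoly set)"
proof -
  have "Q = coord_prime C"
    if Q: "primeideal Q mpoly_ring" "facet_ideal \<B> \<subseteq> Q" "Q \<subseteq> coord_prime C"
    for Q :: "('e, 'k) mpoly set"
  proof -
    have "{e. mvar e \<in> Q} \<subseteq> C" using Q(3) mvar_mem_coord_prime by blast
    then have "{e. mvar e \<in> Q} = C"
      using assms(2) transversal_variables_of_prime[OF Q(1,2)] by blast
    then have "coord_prime C \<subseteq> Q"
      by (intro coord_prime_subset[OF primeideal.axioms(1)[OF Q(1)]]) auto
    with Q(3) show ?thesis by blast
  qed
  then show ?thesis
    using coord_prime_is_prime facet_ideal_subset_coord_prime[OF assms(1)]
    by (auto simp: minimal_primes_def)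
qed

text \<open>A minimal prime is only known to come from some transversal, so the inequality is
  imposed on all of them. Nothing is lost: weights grow with the set, and every transversal contains
  a minimal one.\<close>

lemma symbolic_power_facet_ideal_superset:
  "monomial_ideal {a. \<forall>C. transversal \<B> C \<longrightarrow> weight C a \<ge> s}
    \<subseteq> symbolic_power mpoly_ring (facet_ideal \<B> :: ('e::finite, 'k::field) mpoly set) s"
  unfolding symbolic_power_def
proof (rule INT_greatest)
  fix P assume "P \<in> minimal_primes mpoly_ring (facet_ideal \<B> :: ('e, 'k) mpoly set)"
  then obtain C where "transversal \<B> C" "P = coord_prime C"
    by (rule minimal_primes_facet_idealE)
  then show "monomial_ideal {a. \<forall>C. transversal \<B> C \<longrightarrow> weight C a \<ge> s} \<subseteq> ideal_power mpoly_ring P s"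
    by (auto simp: ideal_power_coord_prime monomial_ideal_def)
qed

lemma symbolic_power_facet_ideal_subset:
  assumes "transversal \<B> C" "\<And>D. D \<subset> C \<Longrightarrow> \<not> transversal \<B> D"
  shows "symbolic_power mpoly_ring (facet_ideal \<B> :: ('e::finite, 'k::field) mpoly set) s
    \<subseteq> monomial_ideal {a. weight C a \<ge> s}"
  using INT_lower[OF coord_prime_mem_minimal_primes[OF assms], of "\<lambda>P. ideal_power mpoly_ring P s"]
  unfolding symbolic_power_def by (simp add: ideal_power_coord_prime)

section \<open>Integer decomposition\<close>

definition blocks :: "('e \<Rightarrow> nat) \<Rightarrow> 'e list \<Rightarrow> 'e list" where
  "blocks c es = concat (map (\<lambda>e. replicate (c e) e) es)"

lemma blocks_simps [simp]:
  "blocks c [] = []" "blocks c (e # es) = replicate (c e) e @ blocks c es"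
  by (simp_all add: blocks_def)

lemma blocks_append: "blocks c (es @ fs) = blocks c es @ blocks c fs"
  by (simp add: blocks_def)

lemma set_blocks_subset: "set (blocks c es) \<subseteq> set es"
  by (auto simp: blocks_def)

lemma length_blocks: "distinct es \<Longrightarrow> length (blocks c es) = sum c (set es)"
  by (induction es) simp_all

lemma count_blocks:
  "distinct es \<Longrightarrow> length (filter ((=) e) (blocks c es)) = (if e \<in> set es then c e else 0)"
proof (induction es)
  case (Cons x es)
  then show ?case by (auto simp: filter_empty_conv)
qed simp

text \<open>Each letter fills only one block because \<open>es\<close> is distinct, so two equal
  letters are less than one block length apart.\<close>

lemma blocks_nth_eq_imp_close:
  assumes "distinct es" "p < q" "q < length (blocks c es)" "blocks c es ! p = blocks c es ! q"
  shows "q - p < c (blocks c es ! p)"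
  using assms
proof (induction es arbitrary: p q)
  case (Cons x es)
  have *: "blocks c es ! i \<noteq> x" if "i < length (blocks c es)" for i
    using Cons.prems(1) subsetD[OF set_blocks_subset nth_mem[OF that]] by auto
  consider "q < c x" | "p < c x" "c x \<le> q" | "c x \<le> p" by linarith
  then show ?case
  proof cases
    case 1
    with Cons.prems show ?thesis by (simp add: nth_append)
  next
    case 2
    then have "q - c x < length (blocks c es)" using Cons.prems(3) by simp
    from *[OF this] Cons.prems(4) 2 have False by (simp add: nth_append)
    then show ?thesis ..
  next
    case 3
    with Cons.prems have "q - c x - (p - c x) < c (blocks c es ! (p - c x))"
      by (intro Cons.IH) (auto simp: nth_append)
    with 3 Cons.prems show ?thesis by (simp add: nth_append)
  qed
qed simp

text \<open>Integer decomposition by wrapping around: write every \<open>e\<close> in a block of \<open>c e \<le> m\<close>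
  consecutive copies and let \<open>S j\<close> collect the letters at positions congruent to \<open>j\<close> modulo
  \<open>m\<close>. Putting the elements outside \<open>B\<^sub>0\<close> first forces every \<open>S j\<close> to leave \<open>B\<^sub>0\<close>.\<close>

lemma wrap_around_decomposition:
  fixes c :: "'e::finite \<Rightarrow> nat"
  assumes c: "\<And>e. c e \<le> m" and total: "m * k \<le> sum c UNIV" and outside: "m \<le> sum c (- B\<^sub>0)"
    and "k > 0"
  obtains S where "\<And>j. j < m \<Longrightarrow> card (S j) = k" "\<And>j. j < m \<Longrightarrow> S j \<noteq> B\<^sub>0"
    "\<And>e. card {j. j < m \<and> e \<in> S j} \<le> c e"
proof -
  obtain es fs where es: "set es = - B\<^sub>0" "distinct es" and fs: "set fs = B\<^sub>0" "distinct fs"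
    using finite_distinct_list[of "- B\<^sub>0"] finite_distinct_list[of B\<^sub>0] by auto
  define w where "w = blocks c (es @ fs)"
  have dist: "distinct (es @ fs)" and univ: "set (es @ fs) = UNIV" using es fs by auto
  have len: "m * k \<le> length w"
    unfolding w_def using total by (simp only: length_blocks[OF dist] univ)
  define S where "S = (\<lambda>j. (\<lambda>i. w ! (j + m * i)) ` {..<k})"
  have pos: "j + m * i < length w" if "j < m" "i < k" for i j
  proof -
    have "j + m * i < m * Suc i" using that by simp
    also have "\<dots> \<le> m * k" using that(2) by (intro mult_le_mono2) simp
    finally show ?thesis using len by linarith
  qed
  \<comment> \<open>Distinct positions in one residue class are at least \<open>m\<close> apart, but
    equal letters \<open>e\<close> are less than \<open>c e \<le> m\<close> apart. Hence the
    \<open>k\<close> letters of \<open>S j\<close> are distinct.\<close>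
  have neq: "w ! (j + m * i) \<noteq> w ! (j + m * i')" if "j < m" "i < i'" "i' < k" for i i' j
  proof
    assume eq: "w ! (j + m * i) = w ! (j + m * i')"
    have le: "m * Suc i \<le> m * i'" using that(2) by (intro mult_le_mono2) simp
    have less: "j + m * i < j + m * i'" using that(1,2) by simp
    have "(j + m * i') - (j + m * i) < c (w ! (j + m * i))"
      using blocks_nth_eq_imp_close[OF dist less, of c] pos[OF that(1,3)] eq unfolding w_def by blast
    with c[of "w ! (j + m * i)"] le show False by simp
  qed
  show ?thesis
  proof (rule that[of S])
    fix j assume j: "j < m"
    have "inj_on (\<lambda>i. w ! (j + m * i)) {..<k}"
      by (rule linorder_inj_onI') (use neq[OF j] in auto)
    then show "card (S j) = k" by (simp add: S_def card_image)
    have "j < length (blocks c es)" using j outside by (simp add: length_blocks[OF es(2)] es(1))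
    then have "w ! j \<in> set es"
      using set_blocks_subset[of c es] by (auto simp: w_def blocks_append nth_append)
    moreover have "w ! j \<in> S j" using \<open>k > 0\<close> by (force simp: S_def)
    ultimately show "S j \<noteq> B\<^sub>0" using es(1) by blast
  next
    fix e
    let ?P = "{p. p < length w \<and> e = w ! p}"
    \<comment> \<open>Every such \<open>j\<close> is the residue of some position holding
      \<open>e\<close>, and at most \<open>c e\<close> positions hold it.\<close>
    have "{j. j < m \<and> e \<in> S j} \<subseteq> (\<lambda>p. p mod m) ` ?P"
    proof safe
      fix j assume j: "j < m" "e \<in> S j"
      then obtain i where i: "i < k" "e = w ! (j + m * i)" by (auto simp: S_def)
      then show "j \<in> (\<lambda>p. p mod m) ` ?P"
        using j pos by (intro image_eqI[of _ _ "j + m * i"]) auto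
    qed
    then have "card {j. j < m \<and> e \<in> S j} \<le> card ((\<lambda>p. p mod m) ` ?P)"
      by (intro card_mono) auto
    also have "\<dots> \<le> card ?P" by (rule card_image_le) simp
    also have "\<dots> = length (filter ((=) e) w)" by (simp add: length_filter_conv_card)
    also have "\<dots> \<le> c e" unfolding w_def by (simp only: count_blocks[OF dist]) simp
    finally show "card {j. j < m \<and> e \<in> S j} \<le> c e" .
  qed
qed

text \<open>A sum of \<open>m\<close> sets uses each element at most \<open>m\<close> times, so
  \<open>a\<close> is capped at \<open>m\<close> before it is decomposed.\<close>

lemma mem_sumset_power_almost_uniform:
  fixes a :: "'e::finite \<Rightarrow>\<^sub>0 nat"
  assumes \<B>: "{B. card B = k} - {B\<^sub>0} \<subseteq> \<B>" and "k > 0"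
    and total: "m * k \<le> (\<Sum>e\<in>UNIV. min (lookup a e) m)" and outside: "m \<le> weight (- B\<^sub>0) a"
  shows "a \<in> sumset_power (facet_exponents \<B>) m"
proof -
  define c where "c = (\<lambda>e. min (lookup a e) m)"
  have "m \<le> sum c (- B\<^sub>0)"
  \<comment> \<open>Capping preserves the inequality outside \<open>B\<^sub>0\<close>: one
    coordinate of size at least \<open>m\<close> suffices on its own, and without one nothing there
    is capped.\<close>
  proof (cases "\<exists>e\<in>- B\<^sub>0. lookup a e \<ge> m")
    case True
    then obtain e where e: "e \<in> - B\<^sub>0" "lookup a e \<ge> m" by blast
    then have "m = c e" by (simp add: c_def)
    also have "\<dots> \<le> sum c (- B\<^sub>0)" by (rule member_le_sum) (use e in auto)
    finally show ?thesis .
  next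
    case False
    then have "sum c (- B\<^sub>0) = weight (- B\<^sub>0) a"
      unfolding weight_def c_def by (intro sum.cong refl min_absorb1) force
    with outside show ?thesis by simp
  qed
  with total \<open>k > 0\<close> obtain S where S: "\<And>j. j < m \<Longrightarrow> card (S j) = k" "\<And>j. j < m \<Longrightarrow> S j \<noteq> B\<^sub>0"
    "\<And>e. card {j. j < m \<and> e \<in> S j} \<le> c e"
    using wrap_around_decomposition[of c m k B\<^sub>0] unfolding c_def by (metis min.cobounded2)
  show ?thesis
  proof (rule mem_sumset_power_facet_exponentsI)
    show "S j \<in> \<B>" if "j < m" for j using S(1,2)[OF that] \<B> by blast
    show "card {j. j < m \<and> e \<in> S j} \<le> lookup a e" for e
      using S(3)[of e] by (simp add: c_def)
  qed
qed

section \<open>Averaging over cocircuits\<close>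

text \<open>Averaging by induction: the bounds for all \<open>A - {x}\<close> are added up, and each
  element of \<open>A\<close> lies in \<open>card A - 1\<close> of these sets.\<close>

lemma sum_ge_of_subsets_ge:
  fixes g :: "'a \<Rightarrow> real"
  assumes "finite A" "q \<le> card A" "\<And>C. C \<subseteq> A \<Longrightarrow> card C = q \<Longrightarrow> s \<le> sum g C"
  shows "real (card A) * s \<le> real q * sum g A"
  using assms
proof (induction "card A" arbitrary: A rule: less_induct)
  case less
  show ?case
  proof (cases "q = card A \<or> q = 0")
    \<comment> \<open>For \<open>q = 0\<close> the empty subset forces
      \<open>s \<le> 0\<close>.\<close>
    case True
    then show ?thesis using less.prems(3)[of A] less.prems(3)[of "{}"]
      by (auto simp: mult_left_mono mult_nonneg_nonpos)
  next
    case False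
    define p where "p = real (card A) - 1"
    have p: "p > 0" using False less.prems(2) by (auto simp: p_def)
    have "p * s \<le> real q * (sum g A - g x)" if x: "x \<in> A" for x
    proof -
      have card: "card (A - {x}) = card A - 1" using x less.prems(1) by simp
      have "real (card (A - {x})) * s \<le> real q * sum g (A - {x})"
        using False less.prems x by (intro less.hyps) (auto simp: card card_gt_0_iff)
      then show ?thesis
        using x less.prems(1) p card by (simp add: sum_diff1 p_def of_nat_diff)
    qed
    then have "(\<Sum>x\<in>A. p * s) \<le> (\<Sum>x\<in>A. real q * (sum g A - g x))" by (rule sum_mono)
    also have "\<dots> = real q * (p * sum g A)"
      by (simp add: sum_distrib_left[symmetric] sum_subtractf p_def algebra_simps)
    finally have "p * (real (card A) * s) \<le> p * (real q * sum g A)" by (simp add: algebra_simps)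
    then show ?thesis using p by simp
  qed
qed

lemma card_Compl: "card (- C) = card (UNIV :: 'a set) - card C" for C :: "'a::finite set"
  by (simp add: Compl_eq_Diff_UNIV card_Diff_subset)

text \<open>With \<open>A\<close> the set where \<open>a e < m\<close>, the sum is
  \<open>weight A a + (n - card A) * m\<close>, so \<open>weight A a\<close> must be at least
  \<open>m * (card A - (n - k))\<close>. This is trivial if \<open>A\<close> has at most
  \<open>n - k\<close> elements, follows by averaging over the \<open>(n - k + 1)\<close>-subsets of
  \<open>A\<close> if \<open>A\<close> is a larger proper subset, and uses the inequality for
  \<open>- B\<^sub>0\<close> if \<open>A = UNIV\<close>.\<close>

lemma sum_min_ge_of_cocircuits_ge:
  fixes a :: "'e::finite \<Rightarrow>\<^sub>0 nat" and k n m s :: nat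
  assumes n: "card (UNIV :: 'e set) = n" and k: "k \<ge> 1" "k < n" and B\<^sub>0: "card B\<^sub>0 = k"
    and outside: "s \<le> weight (- B\<^sub>0) a"
    and cocircuit: "\<And>C. card C = n - k + 1 \<Longrightarrow> s \<le> weight C a"
    and s1: "real m * (real k * (real n - real k)) \<le> real s * (real n - 1)"
    and s2: "real m * ((real k - 1) * (real n - real k + 1)) \<le> real s * (real n - 1)"
  shows "m * k \<le> (\<Sum>e\<in>UNIV. min (lookup a e) m)"
proof -
  define g where "g = (\<lambda>e. real (lookup a e))"
  have weight: "real (weight W a) = sum g W" for W
    by (simp add: weight_def g_def)
  define N K M T where "N = real n" "K = real k" "M = real m" "T = real s"
  note defs = N_K_M_T_def
  have K: "K \<ge> 1" "K + 1 \<le> N" using k by (auto simp: defs)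
  have M: "M \<ge> 0" "T \<ge> 0" by (auto simp: defs)
  have nk: "real (n - k) = N - K" "real (n - k + 1) = N - K + 1"
    using k by (auto simp: defs of_nat_diff)
  have s1: "M * (K * (N - K)) \<le> T * (N - 1)" and s2: "M * ((K - 1) * (N - K + 1)) \<le> T * (N - 1)"
    using s1 s2 by (simp_all add: defs)
  have cocircuit: "T \<le> sum g C" if "card C = n - k + 1" for C
    using cocircuit[OF that] by (simp add: defs flip: weight)
  have outside: "T \<le> sum g (- B\<^sub>0)" using outside by (simp add: defs flip: weight)
  have card_outside: "card (- B\<^sub>0) = n - k" using n B\<^sub>0 by (simp add: card_Compl)
  have proper: "M * (real (card A) - (N - K)) \<le> sum g A" if A: "card A < n" "card A \<ge> n - k + 1" for A
  proof -
    define p where "p = real (card A)"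
    have p: "p \<le> N - 1" "p \<ge> 0" using A k by (auto simp: p_def defs)
    \<comment> \<open>Averaging and \<open>s2\<close> give
      \<open>sum g A \<ge> M * p * (K - 1) / (N - 1)\<close>. This bound exceeds the target by
      \<open>M * (N - K) * (N - 1 - p) / (N - 1)\<close>, which vanishes at
      \<open>p = N - 1\<close>.\<close>
    have "0 \<le> (N - K) * (N - 1 - p)" using p K by simp
    then have "(N - 1) * (p - (N - K)) \<le> p * (K - 1)" by (simp add: algebra_simps)
    then have "M * (N - K + 1) * ((N - 1) * (p - (N - K))) \<le> M * (N - K + 1) * (p * (K - 1))"
      using K M by (intro mult_left_mono) auto
    also have "\<dots> = p * (M * ((K - 1) * (N - K + 1)))" by simp
    also have "\<dots> \<le> p * (T * (N - 1))" using s2 p by (intro mult_left_mono)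
    also have "\<dots> = (N - 1) * (p * T)" by simp
    also have "\<dots> \<le> (N - 1) * ((N - K + 1) * sum g A)"
    proof (rule mult_left_mono)
      show "p * T \<le> (N - K + 1) * sum g A"
        unfolding p_def nk(2)[symmetric] using A(2) cocircuit by (intro sum_ge_of_subsets_ge) auto
    qed (use K in simp)
    finally have "((N - 1) * (N - K + 1)) * (M * (p - (N - K))) \<le> ((N - 1) * (N - K + 1)) * sum g A"
      by (simp add: algebra_simps)
    then show ?thesis using K by (simp add: p_def)
  qed
  have total: "M * K \<le> sum g UNIV"
  proof -
    define p q where "p = sum g (- B\<^sub>0)" "q = sum g B\<^sub>0"
    have pq: "sum g UNIV = p + q"
      using sum.union_disjoint[of "- B\<^sub>0" B\<^sub>0 g] by (simp add: p_q_def Compl_partition2)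
    show ?thesis
    proof (cases "2 * k \<le> n + 1")
      case True
      \<comment> \<open>Here \<open>B\<^sub>0\<close> fits into a set of \<open>n - k + 1\<close>
        elements with room for \<open>n + 1 - 2 * k\<close> more; the averaging runs over these
        remainders \<open>D\<close>.\<close>
      have "T - q \<le> sum g D" if D: "D \<subseteq> - B\<^sub>0" "card D = n + 1 - 2 * k" for D
      proof -
        have "card (D \<union> B\<^sub>0) = n + 1 - 2 * k + k"
          using D B\<^sub>0 by (subst card_Un_disjoint) auto
        then have "T \<le> sum g (D \<union> B\<^sub>0)" using True k by (intro cocircuit) simp
        also have "\<dots> = sum g D + q"
          using D by (subst sum.union_disjoint) (auto simp: p_q_def)
        finally show ?thesis by simp
      qed
      then have "real (card (- B\<^sub>0)) * (T - q) \<le> real (n + 1 - 2 * k) * p"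
        unfolding p_q_def(1) using k by (intro sum_ge_of_subsets_ge) (auto simp: card_outside)
      moreover have "real (n + 1 - 2 * k) = N + 1 - 2 * K" using True by (simp add: defs of_nat_diff)
      ultimately have "(N - K) * (T - q) \<le> (N + 1 - 2 * K) * p"
        by (simp only: card_outside nk)
      \<comment> \<open>With the factor \<open>K - 1\<close>, adding the two bounds gives both
        \<open>p\<close> and \<open>q\<close> the coefficient \<open>N - K\<close>, and
        \<open>T\<close> the coefficient \<open>N - 1\<close>.\<close>
      moreover have "(K - 1) * T \<le> (K - 1) * p"
        using outside K by (simp add: p_q_def mult_left_mono)
      ultimately have "T * (N - 1) \<le> (N - K) * (p + q)" by (simp add: algebra_simps)
      with s1 have "(N - K) * (M * K) \<le> (N - K) * (p + q)" by (simp add: algebra_simps)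
      then show ?thesis using K by (simp add: pq)
    next
      case False
      \<comment> \<open>Now sets of \<open>n - k + 1\<close> elements fit inside
        \<open>B\<^sub>0\<close>, and averaging there bounds \<open>q\<close>.\<close>
      have "real (card B\<^sub>0) * T \<le> real (n - k + 1) * q"
        unfolding p_q_def using B\<^sub>0 False cocircuit by (intro sum_ge_of_subsets_ge) auto
      then have q: "K * T \<le> (N - K + 1) * q" unfolding nk(2) B\<^sub>0 by (simp add: defs)
      have p: "(N - K + 1) * T \<le> (N - K + 1) * p"
        using outside K by (intro mult_left_mono) (auto simp: p_q_def)
      have total: "(N + 1) * T \<le> (N - K + 1) * (p + q)" using p q by (simp add: algebra_simps)
      \<comment> \<open>Equivalent to \<open>N + 1 \<le> 2 * K\<close>, which the case provides;
        thus \<open>s2\<close> serves here in place of \<open>s1\<close>.\<close>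
      have "K * (N - 1) \<le> (N + 1) * (K - 1)" using False by (simp add: defs algebra_simps)
      then have "M * (N - K + 1) * (K * (N - 1)) \<le> M * (N - K + 1) * ((N + 1) * (K - 1))"
        using M K by (intro mult_left_mono) auto
      also have "\<dots> = (N + 1) * (M * ((K - 1) * (N - K + 1)))" by simp
      also have "\<dots> \<le> (N + 1) * (T * (N - 1))" using s2 K by (intro mult_left_mono) auto
      also have "\<dots> = (N - 1) * ((N + 1) * T)" by simp
      also have "\<dots> \<le> (N - 1) * ((N - K + 1) * (p + q))" using total K by (intro mult_left_mono) auto
      finally have "((N - 1) * (N - K + 1)) * (M * K) \<le> ((N - 1) * (N - K + 1)) * (p + q)"
        by (simp add: algebra_simps)
      then show ?thesis using K by (simp add: pq)
    qed
  qed
  define A where "A = {e. lookup a e < m}"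
  have "(\<Sum>e\<in>UNIV. min (lookup a e) m) = (\<Sum>e\<in>A. min (lookup a e) m) + (\<Sum>e\<in>- A. min (lookup a e) m)"
    by (subst sum.union_disjoint[symmetric]) (auto simp: Compl_partition)
  also have "(\<Sum>e\<in>A. min (lookup a e) m) = weight A a"
    unfolding weight_def by (intro sum.cong) (auto simp: A_def)
  also have "(\<Sum>e\<in>- A. min (lookup a e) m) = (\<Sum>e\<in>- A. m)"
    by (intro sum.cong) (auto simp: A_def)
  finally have eq: "(\<Sum>e\<in>UNIV. min (lookup a e) m) = weight A a + (n - card A) * m"
    by (simp add: card_Compl n)
  have card_A: "card A \<le> n" using card_mono[of UNIV A] n by simp
  have "M * K \<le> sum g A + (N - real (card A)) * M"
  proof -
    consider "card A \<le> n - k" | "card A < n" "card A \<ge> n - k + 1" | "A = UNIV"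
      using card_A n card_subset_eq[of UNIV A] by fastforce
    then show ?thesis
    proof cases
      case 1
      then have "real (card A) \<le> N - K" using nk(1) by linarith
      then have "M * K \<le> M * (N - real (card A))" using M by (intro mult_left_mono) auto
      moreover have "0 \<le> sum g A" by (simp add: g_def sum_nonneg)
      ultimately show ?thesis by (simp add: mult.commute)
    next
      case 2
      from proper[OF this] show ?thesis by (simp add: algebra_simps)
    next
      case 3
      with total n show ?thesis by (simp add: defs)
    qed
  qed
  then have "real (m * k) \<le> real (weight A a + (n - card A) * m)"
    using card_A by (simp add: weight of_nat_diff defs)
  then show ?thesis unfolding eq by linarith
qed

section \<open>Almost-uniform matroids\<close>

locale almost_uniform =
  fixes \<B> :: "'e::finite set set" and k n :: nat and B\<^sub>0 :: "'e set"
  assumes n: "card (UNIV :: 'e set) = n" and k: "k \<ge> 1" "k < n" and B\<^sub>0: "card B\<^sub>0 = k"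
    and \<B>: "\<B> = {B. card B = k} - {B\<^sub>0}"
begin

lemma card_compl: "card (- C) = n - card C" "card C \<le> n" for C :: "'e set"
  using n card_mono[of UNIV C] by (simp_all add: card_Compl)

text \<open>The complement of \<open>C\<close> has at least \<open>k\<close> elements. One of them
  outside \<open>B\<^sub>0\<close> could be completed to a \<open>k\<close>-set avoiding
  \<open>C\<close> and different from \<open>B\<^sub>0\<close>, that is, to a basis. So
  \<open>- C \<subseteq> B\<^sub>0\<close>, with equality by size.\<close>

lemma small_transversal:
  assumes "transversal \<B> C" "card C \<le> n - k"
  shows "C = - B\<^sub>0"
proof -
  have card: "k \<le> card (- C)" using assms(2) k card_compl[of C] by simp
  have "- C \<subseteq> B\<^sub>0"
  proof
    fix x assume x: "x \<in> - C"
    show "x \<in> B\<^sub>0"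
    proof (rule ccontr)
      assume "x \<notin> B\<^sub>0"
      have "k - 1 \<le> card (- C - {x})" using card x by simp
      then obtain T where T: "T \<subseteq> - C - {x}" "card T = k - 1"
        using obtain_subset_with_card_n by metis
      then have "insert x T \<in> \<B>"
        using k \<open>x \<notin> B\<^sub>0\<close> by (auto simp: \<B> card_insert_if)
      with assms(1) T x show False by (auto simp: transversal_def)
    qed
  qed
  with card B\<^sub>0 have "- C = B\<^sub>0" using card_seteq[of B\<^sub>0 "- C"] by simp
  then show ?thesis by auto
qed

text \<open>The only \<open>k\<close>-subset of \<open>B\<^sub>0\<close> is \<open>B\<^sub>0\<close>
  itself, so every basis leaves it; minimality comes from \<open>small_transversal\<close>.\<close>

lemma cocircuit_complement:
  "transversal \<B> (- B\<^sub>0)" "D \<subset> - B\<^sub>0 \<Longrightarrow> \<not> transversal \<B> D"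
proof -
  have "B = B\<^sub>0" if "B \<subseteq> B\<^sub>0" "card B = k" for B
    using that B\<^sub>0 card_subset_eq[of B\<^sub>0 B] by simp
  then show "transversal \<B> (- B\<^sub>0)" by (auto simp: transversal_def \<B>)
  assume D: "D \<subset> - B\<^sub>0"
  then have "card D \<le> n - k" using psubset_card_mono[of "- B\<^sub>0" D] B\<^sub>0 by (simp add: card_compl)
  then show "\<not> transversal \<B> D" using small_transversal D by blast
qed

text \<open>The sizes of a basis and \<open>C\<close> add up to \<open>n + 1\<close>, so they meet.
  Containing \<open>- B\<^sub>0\<close> would spoil minimality.\<close>

lemma cocircuit_generic:
  assumes "card C = n - k + 1" "\<not> - B\<^sub>0 \<subseteq> C"
  shows "transversal \<B> C" "D \<subset> C \<Longrightarrow> \<not> transversal \<B> D"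
proof -
  have "B \<inter> C \<noteq> {}" if "card B = k" for B
  proof
    assume "B \<inter> C = {}"
    then have "card (B \<union> C) = k + (n - k + 1)"
      using that assms(1) by (simp add: card_Un_disjoint)
    then show False using card_compl(2)[of "B \<union> C"] k by simp
  qed
  then show "transversal \<B> C" by (auto simp: transversal_def \<B>)
  assume D: "D \<subset> C"
  then have "card D \<le> n - k" using psubset_card_mono[of C D] assms(1) by simp
  then show "\<not> transversal \<B> D" using small_transversal D assms(2) by blast
qed

lemma symbolic_power_weight:
  assumes "f \<in> symbolic_power mpoly_ring (facet_ideal \<B> :: ('e, 'k::field) mpoly set) s"
    and "a \<in> Poly_Mapping.keys f"
  shows "s \<le> weight (- B\<^sub>0) a" "card C = n - k + 1 \<Longrightarrow> s \<le> weight C a"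
proof -
  have *: "s \<le> weight C a" if "transversal \<B> C" "\<And>D. D \<subset> C \<Longrightarrow> \<not> transversal \<B> D" for C
    using symbolic_power_facet_ideal_subset[OF that, where 'k = 'k] assms
    unfolding monomial_ideal_def by blast
  show outside: "s \<le> weight (- B\<^sub>0) a" using *[OF cocircuit_complement] .
  show "s \<le> weight C a" if "card C = n - k + 1"
  proof (cases "- B\<^sub>0 \<subseteq> C")
    \<comment> \<open>Such a \<open>C\<close> is not a minimal transversal, but its weight is at
      least that of \<open>- B\<^sub>0\<close>.\<close>
    case True
    then show ?thesis using outside weight_mono[of C "- B\<^sub>0" a] by simp
  next
    case False
    show ?thesis using * cocircuit_generic[OF that False] by blast
  qed
qed

lemma symbolic_power_subset:
  assumes "real m * (real k * (real n - real k)) \<le> real s * (real n - 1)"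
    and "real m * ((real k - 1) * (real n - real k + 1)) \<le> real s * (real n - 1)"
  shows "symbolic_power mpoly_ring (facet_ideal \<B> :: ('e, 'k::field) mpoly set) s
    \<subseteq> ideal_power mpoly_ring (facet_ideal \<B>) m"
proof -
  \<comment> \<open>The product is the difference of \<open>k * (n - k)\<close> and
    \<open>n - 1\<close>, so the first hypothesis yields \<open>m \<le> s\<close>; this turns the
    bound \<open>s\<close> outside \<open>B\<^sub>0\<close> into the bound \<open>m\<close>.\<close>
  have "0 \<le> (real k - 1) * (real n - real k - 1)" using k by simp
  then have "real n - 1 \<le> real k * (real n - real k)" by (simp add: algebra_simps)
  then have "real m * (real n - 1) \<le> real m * (real k * (real n - real k))"
    by (intro mult_left_mono) auto
  with assms(1) have "real m * (real n - 1) \<le> real s * (real n - 1)" by simp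
  then have "m \<le> s" using k by simp
  have "a \<in> sumset_power (facet_exponents \<B>) m"
    if f: "f \<in> symbolic_power mpoly_ring (facet_ideal \<B> :: ('e, 'k::field) mpoly set) s"
      and a: "a \<in> Poly_Mapping.keys f" for f a
  proof (rule mem_sumset_power_almost_uniform)
    show "m * k \<le> (\<Sum>e\<in>UNIV. min (lookup a e) m)"
      using sum_min_ge_of_cocircuits_ge[OF n k B\<^sub>0 symbolic_power_weight[OF f a] assms(1,2)] by blast
    show "m \<le> weight (- B\<^sub>0) a" using symbolic_power_weight(1)[OF f a] \<open>m \<le> s\<close> by simp
  qed (use k in \<open>auto simp: \<B>\<close>)
  then show ?thesis unfolding ideal_power_facet_ideal monomial_ideal_def by blast
qed

text \<open>The monomial \<open>x^a\<close> is the witness: it satisfies every inequality of the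
  symbolic power, while its weight on \<open>W\<close> is too small for a product of
  \<open>m\<close> bases.\<close>

lemma not_symbolic_power_subset:
  assumes "\<And>C. transversal \<B> C \<Longrightarrow> s \<le> weight C a"
    and "\<And>B. B \<in> \<B> \<Longrightarrow> c \<le> card (W \<inter> B)" "weight W a < m * c"
  shows "\<not> symbolic_power mpoly_ring (facet_ideal \<B> :: ('e, 'k::field) mpoly set) s
    \<subseteq> ideal_power mpoly_ring (facet_ideal \<B>) m"
proof
  assume sub: "symbolic_power mpoly_ring (facet_ideal \<B> :: ('e, 'k) mpoly set) s
    \<subseteq> ideal_power mpoly_ring (facet_ideal \<B>) m"
  have "(Poly_Mapping.single a 1 :: ('e, 'k) mpoly) \<in> symbolic_power mpoly_ring (facet_ideal \<B>) s"
    using assms(1)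
    by (intro subsetD[OF symbolic_power_facet_ideal_superset]) auto
  with sub have "(Poly_Mapping.single a 1 :: ('e, 'k) mpoly) \<in> ideal_power mpoly_ring (facet_ideal \<B>) m"
    by blast
  then have "a \<in> sumset_power (facet_exponents \<B>) m"
    by (simp add: ideal_power_facet_ideal)
  then have "m * c \<le> weight W a"
    using assms(2) by (intro weight_sumset_power_facet_exponents) auto
  with assms(3) show False by simp
qed

end

text \<open>The exponent vector that is constant except at the distinguished element \<open>f\<close>: with
  \<open>y = 0\<close> it lives on the deletion of \<open>f\<close>, with large \<open>y\<close> on the contraction.\<close>

definition exponent_const_except :: "'e::finite \<Rightarrow> nat \<Rightarrow> nat \<Rightarrow> 'e \<Rightarrow>\<^sub>0 nat" where
  "exponent_const_except f x y = Abs_poly_mapping (\<lambda>e. if e = f then y else x)"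

lemma weight_exponent_const_except:
  "weight C (exponent_const_except f x y) = card (C - {f}) * x + (if f \<in> C then y else 0)"
proof -
  have "lookup (exponent_const_except f x y) = (\<lambda>e. if e = f then y else x)"
    unfolding exponent_const_except_def by (rule lookup_Abs_poly_mapping) simp
  then have "weight C (exponent_const_except f x y) = (\<Sum>e\<in>C. if e = f then y else x)"
    by (simp add: weight_def)
  then show ?thesis by (auto simp: sum.If_cases Diff_eq Int_insert_right)
qed

text \<open>After multiplication by \<open>d\<close>, rounding up costs at most
  \<open>l * d\<close>. Integrality turns the first hypothesis into
  \<open>s * l + 1 \<le> r * c * d\<close>, whose slack, multiplied by \<open>t\<close>, exceeds
  this cost.\<close>

lemma rounded_quotient_less:
  fixes s r c d l t :: nat
  assumes "s * l < r * c * d" "t > l * d" "d > 0"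
  shows "l * (s * t div d + 1) < r * t * c"
proof -
  have "d * (l * (s * t div d + 1)) \<le> l * (s * t + d)"
    using mult_le_mono2[OF times_div_less_eq_dividend[of d "s * t"], of l] by (simp add: algebra_simps)
  also have "\<dots> < t * (s * l + 1)" using assms(2) by (simp add: algebra_simps)
  also have "\<dots> \<le> t * (r * c * d)" using assms(1) by (intro mult_le_mono2) simp
  also have "\<dots> = d * (r * t * c)" by simp
  finally show ?thesis using mult_less_cancel1 by blast
qed

section \<open>Lower bound: containments that fail on a deletion and on a contraction\<close>

context almost_uniform
begin

text \<open>For \<open>e \<in> B\<^sub>0\<close>, every transversal keeps at least
  \<open>n - k\<close> elements when \<open>e\<close> is removed: \<open>- B\<^sub>0\<close> does
  not contain \<open>e\<close>, and all others have more than \<open>n - k\<close> elements.\<close>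

lemma eventually_not_subset_deletion:
  assumes "s * (n - 1) < r * k * (n - k)"
  shows "\<forall>\<^sub>F t in sequentially.
    \<not> symbolic_power mpoly_ring (facet_ideal \<B> :: ('e, 'k::field) mpoly set) (s * t)
      \<subseteq> ideal_power mpoly_ring (facet_ideal \<B>) (r * t)"
proof (rule eventually_mono[OF eventually_gt_at_top[of "(n - 1) * (n - k)"]])
  fix t assume t: "(n - 1) * (n - k) < t"
  obtain e where e: "e \<in> B\<^sub>0" using k B\<^sub>0 by fastforce
  \<comment> \<open>Just above \<open>s * t / (n - k)\<close>, so that \<open>n - k\<close>
    coordinates already reach \<open>s * t\<close>.\<close>
  define x where "x = s * t div (n - k) + 1"
  have x: "s * t \<le> (n - k) * x"
    unfolding x_def using dividend_less_times_div[of "n - k" "s * t"] k by simp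
  show "\<not> symbolic_power mpoly_ring (facet_ideal \<B> :: ('e, 'k::field) mpoly set) (s * t)
      \<subseteq> ideal_power mpoly_ring (facet_ideal \<B>) (r * t)"
  proof (rule not_symbolic_power_subset[where a = "exponent_const_except e x 0" and c = k and W = UNIV])
    fix C assume C: "transversal \<B> C"
    have "n - k \<le> card (C - {e})"
    proof (cases "card C \<le> n - k")
      case True
      then show ?thesis using small_transversal[OF C] e B\<^sub>0 by (simp add: card_compl)
    next
      case False
      then show ?thesis by (auto simp: card_Diff_singleton_if)
    qed
    then have "(n - k) * x \<le> card (C - {e}) * x" by (rule mult_le_mono1)
    from order_trans[OF x this] show "s * t \<le> weight C (exponent_const_except e x 0)"
      by (simp add: weight_exponent_const_except)
  next
    show "weight UNIV (exponent_const_except e x 0) < r * t * k"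
      using rounded_quotient_less[OF assms t] k n
      by (simp add: weight_exponent_const_except x_def card_Diff_singleton)
  qed (auto simp: \<B>)
qed

text \<open>For \<open>f\<close> outside \<open>B\<^sub>0\<close>, the exponent \<open>s * t\<close>
  at \<open>f\<close> settles every transversal through \<open>f\<close>. Those avoiding
  \<open>f\<close> differ from \<open>- B\<^sub>0\<close> and so have at least
  \<open>n - k + 1\<close> elements. Weights are compared off \<open>f\<close>, where each basis
  keeps at least \<open>k - 1\<close> elements.\<close>

lemma eventually_not_subset_contraction:
  assumes "s * (n - 1) < r * (k - 1) * (n - k + 1)"
  shows "\<forall>\<^sub>F t in sequentially.
    \<not> symbolic_power mpoly_ring (facet_ideal \<B> :: ('e, 'k::field) mpoly set) (s * t)
      \<subseteq> ideal_power mpoly_ring (facet_ideal \<B>) (r * t)"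
proof (rule eventually_mono[OF eventually_gt_at_top[of "(n - 1) * (n - k + 1)"]])
  fix t assume t: "(n - 1) * (n - k + 1) < t"
  have "B\<^sub>0 \<noteq> UNIV" using k n B\<^sub>0 by auto
  then obtain f where f: "f \<notin> B\<^sub>0" by blast
  define x where "x = s * t div (n - k + 1) + 1"
  have x: "s * t \<le> (n - k + 1) * x"
    unfolding x_def using dividend_less_times_div[of "n - k + 1" "s * t"] by simp
  show "\<not> symbolic_power mpoly_ring (facet_ideal \<B> :: ('e, 'k::field) mpoly set) (s * t)
      \<subseteq> ideal_power mpoly_ring (facet_ideal \<B>) (r * t)"
  proof (rule not_symbolic_power_subset[where a = "exponent_const_except f x (s * t)"
        and c = "k - 1" and W = "- {f}"])
    fix C assume C: "transversal \<B> C"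
    show "s * t \<le> weight C (exponent_const_except f x (s * t))"
    proof (cases "f \<in> C")
      case True
      then show ?thesis by (simp add: weight_exponent_const_except)
    next
      case False
      then have "n - k + 1 \<le> card C" using small_transversal[OF C] f by (cases "card C \<le> n - k") auto
      then have "(n - k + 1) * x \<le> card C * x" by (rule mult_le_mono1)
      from order_trans[OF x this] False show ?thesis by (simp add: weight_exponent_const_except)
    qed
  next
    show "weight (- {f}) (exponent_const_except f x (s * t)) < r * t * (k - 1)"
      using rounded_quotient_less[OF assms t] k n
      by (simp add: weight_exponent_const_except x_def card_Compl)
  next
    fix B assume "B \<in> \<B>"
    moreover have "- {f} \<inter> B = B - {f}" by auto
    ultimately show "k - 1 \<le> card (- {f} \<inter> B)" by (simp add: \<B> card_Diff_singleton_if)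
  qed
qed

lemma asymptotic_resurgence_facet_ideal:
  "asymptotic_resurgence mpoly_ring (facet_ideal \<B> :: ('e, 'k::field) mpoly set)
    = ereal (max ((real k - 1) * (real n - real k + 1) / (real n - 1))
                 (real k * (real n - real k) / (real n - 1)))"
    (is "_ = ereal ?\<rho>")
proof -
  define \<rho> where "\<rho> = ?\<rho>"
  let ?P = "\<lambda>s r. \<forall>\<^sub>F t in sequentially.
    \<not> symbolic_power mpoly_ring (facet_ideal \<B> :: ('e, 'k::field) mpoly set) (s * t)
      \<subseteq> ideal_power mpoly_ring (facet_ideal \<B>) (r * t)"
  have n1: "real n - 1 > 0" using k by simp
  have nat: "real (n - 1) = real n - 1" "real (n - k) = real n - real k" "real (k - 1) = real k - 1"
    using k by (auto simp: of_nat_diff)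
  have upper: "real s / real r \<le> \<rho>" if "r \<ge> 1" and P: "?P s r" for s r
  proof (rule ccontr)
    assume "\<not> ?thesis"
    then have "(real k - 1) * (real n - real k + 1) / (real n - 1) \<le> real s / real r"
      "real k * (real n - real k) / (real n - 1) \<le> real s / real r"
      by (simp_all add: \<rho>_def)
    then have le: "real r * ((real k - 1) * (real n - real k + 1)) \<le> real s * (real n - 1)"
      "real r * (real k * (real n - real k)) \<le> real s * (real n - 1)"
      using n1 that(1) by (simp_all add: divide_le_eq le_divide_eq mult.commute mult.left_commute)
    have "symbolic_power mpoly_ring (facet_ideal \<B> :: ('e, 'k) mpoly set) (s * t)
      \<subseteq> ideal_power mpoly_ring (facet_ideal \<B>) (r * t)" for t
    proof (rule symbolic_power_subset)
      show "real (r * t) * (real k * (real n - real k)) \<le> real (s * t) * (real n - 1)"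
        using mult_left_mono[OF le(2), of "real t"] by (simp add: mult_ac)
      show "real (r * t) * ((real k - 1) * (real n - real k + 1)) \<le> real (s * t) * (real n - 1)"
        using mult_left_mono[OF le(1), of "real t"] by (simp add: mult_ac)
    qed
    with P show False by simp
  qed
  have lower: "?P s r" if "r \<ge> 1" and less: "real s / real r < \<rho>" for s r
  proof -
    have "real s / real r < (real k - 1) * (real n - real k + 1) / (real n - 1)
      \<or> real s / real r < real k * (real n - real k) / (real n - 1)"
      using less by (simp add: \<rho>_def less_max_iff_disj)
    then show ?thesis
    proof
      assume "real s / real r < (real k - 1) * (real n - real k + 1) / (real n - 1)"
      then have "real s * (real n - 1) < real r * (real k - 1) * (real n - real k + 1)"
        using n1 that(1) by (simp add: divide_less_eq less_divide_eq mult_ac)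
      then have "real (s * (n - 1)) < real (r * (k - 1) * (n - k + 1))"
        by (simp only: nat of_nat_mult of_nat_add of_nat_1)
      then show ?thesis by (intro eventually_not_subset_contraction) (simp only: of_nat_less_iff)
    next
      assume "real s / real r < real k * (real n - real k) / (real n - 1)"
      then have "real s * (real n - 1) < real r * real k * (real n - real k)"
        using n1 that(1) by (simp add: divide_less_eq less_divide_eq mult_ac)
      then have "real (s * (n - 1)) < real (r * k * (n - k))"
        by (simp only: nat of_nat_mult of_nat_add of_nat_1)
      then show ?thesis by (intro eventually_not_subset_deletion) (simp only: of_nat_less_iff)
    qed
  qed
  have "\<rho> \<ge> real k * (real n - real k) / (real n - 1)" by (simp add: \<rho>_def)
  moreover have "real k * (real n - real k) / (real n - 1) > 0" using k n1 by simp
  ultimately have pos: "\<rho> > 0" by linarith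
  show ?thesis
    unfolding asymptotic_resurgence_def \<rho>_def[symmetric]
  proof (rule antisym)
    show "Sup {ereal (real s / real r) | s r. s \<ge> 1 \<and> r \<ge> 1 \<and> ?P s r} \<le> ereal \<rho>"
      using upper by (intro Sup_least) auto
    show "ereal \<rho> \<le> Sup {ereal (real s / real r) | s r. s \<ge> 1 \<and> r \<ge> 1 \<and> ?P s r}"
      unfolding le_Sup_iff
    proof (intro allI impI)
      fix y assume y: "y < ereal \<rho>"
      \<comment> \<open>\<open>y\<close> may be negative or \<open>-\<infinity>\<close>; passing to
        \<open>max y 0\<close> makes the rational \<open>q\<close> positive, which gives
        \<open>s \<ge> 1\<close>.\<close>
      then have "max y 0 < ereal \<rho>" using pos by (simp add: zero_ereal_def)
      then obtain z where z: "max y 0 < ereal z" "ereal z < ereal \<rho>"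
        using ereal_dense2 by blast
      obtain q where q: "q \<in> \<rat>" "z < q" "q < \<rho>"
        using Rats_dense_in_real[of z \<rho>] z(2) by auto
      have "0 < z" using z(1) by (simp add: zero_ereal_def)
      then obtain s r where sr: "r \<noteq> 0" "\<bar>q\<bar> = real s / real r"
        using Rats_abs_nat_div_natE[OF q(1)] by metis
      then have eq: "q = real s / real r" using \<open>0 < z\<close> q(2) by simp
      have "s \<ge> 1" "r \<ge> 1" using eq sr(1) \<open>0 < z\<close> q(2) by (cases s; auto)+
      moreover from this have "?P s r" using q(3) eq by (intro lower) auto
      moreover have "y < ereal (real s / real r)"
      proof -
        have "y < ereal z" using z(1) by simp
        also have "ereal z < ereal (real s / real r)" using q(2) eq by simp
        finally show ?thesis .
      qed
      ultimately show "\<exists>a\<in>{ereal (real s / real r) | s r. s \<ge> 1 \<and> r \<ge> 1 \<and> ?P s r}. y < a"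
        by blast
    qed
  qed
qed

end

theorem theorem5p6:
  fixes \<B> :: "'e::finite set set" and k n :: nat
  assumes "almost_uniform_matroid (UNIV :: 'e set) k \<B>"
    and "card (UNIV :: 'e set) = n"
    and "k < n"
  shows "asymptotic_resurgence mpoly_ring (facet_ideal \<B> :: ('e, 'k::field) mpoly set)
           = ereal (max ((real k - 1) * (real n - real k + 1) / (real n - 1))
                        (real k * (real n - real k) / (real n - 1)))
       \<and> (2 * k \<le> n + 1 \<longrightarrow>
            asymptotic_resurgence mpoly_ring (facet_ideal \<B> :: ('e, 'k) mpoly set)
              = ereal (real k * (real n - real k) / (real n - 1)))
       \<and> (2 * k \<ge> n + 1 \<longrightarrow>
            asymptotic_resurgence mpoly_ring (facet_ideal \<B> :: ('e, 'k) mpoly set)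
              = ereal ((real k - 1) * (real n - real k + 1) / (real n - 1)))"
proof -
  from assms(1) obtain B\<^sub>0 where B\<^sub>0: "card B\<^sub>0 = k" and
    "\<B> = {B. B \<subseteq> UNIV \<and> card B = k} - {B\<^sub>0}" and ne: "\<B> \<noteq> {}"
    unfolding almost_uniform_matroid_def matroid_def by blast
  then have \<B>: "\<B> = {B. card B = k} - {B\<^sub>0}" by simp
  \<comment> \<open>For \<open>k = 0\<close> the empty set is the only \<open>k\<close>-set, so
    excluding \<open>B\<^sub>0\<close> would leave no basis.\<close>
  have "k \<noteq> 0"
  proof
    assume "k = 0"
    then have "{B :: 'e set. card B = k} = {B\<^sub>0}" using B\<^sub>0 by auto
    then show False using ne unfolding \<B> by simp
  qed
  then have k: "k \<ge> 1" by simp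
  interpret almost_uniform \<B> k n B\<^sub>0
    using assms(2,3) k B\<^sub>0 \<B> by (intro almost_uniform.intro)
  let ?c = "(real k - 1) * (real n - real k + 1)" and ?d = "real k * (real n - real k)"
  \<comment> \<open>The sign of this difference decides which entry of the maximum is
    larger.\<close>
  have diff: "?d - ?c = real (n + 1) - real (2 * k)" by (simp add: algebra_simps)
  have n1: "real n - 1 > 0" using k assms(3) by simp
  have "?c / (real n - 1) \<le> ?d / (real n - 1)" if "2 * k \<le> n + 1"
    using that diff n1 by (intro divide_right_mono) auto
  moreover have "?d / (real n - 1) \<le> ?c / (real n - 1)" if "2 * k \<ge> n + 1"
    using that diff n1 by (intro divide_right_mono) auto
  ultimately show ?thesis
    by (simp only: asymptotic_resurgence_facet_ideal) (auto simp: max_absorb1 max_absorb2)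
qed

end
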